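(* Let $G$ be a Lie group of dimension $n$ with Lie algebra $\mathfrak{g}$ of left invariant vector fields, let $g$ be a left invariant Riemannian metric on $G$ and let $\langle\ ,\ \rangle$ be the corresponding scalar product on $\mathfrak{g}$. Let $\{E_i\}_{i=1}^n$ be a frame (basis) of $\mathfrak{g}$ orthonormal with respect to $\langle\ ,\ \rangle$, with structure constants $c^k_{ij}$ defined by $[E_i,E_j]=\sum_k c^k_{ij}E_k$. Then the coordinates $R_{jk}$ of the Ricci tensor of $g$ with respect to $\{E_i\}$ are $$R_{jk} = \overset{1}{R}_{jk} + \overset{2}{R}_{jk} + \overset{3}{R}_{jk} + \overset{4}{R}_{jk},$$ where $$\overset{1}{R}_{jk} = -\frac12\sum_{s,m=1}^n c^s_{mj}c^m_{sk},\qquad \overset{2}{R}_{jk}=\frac12\sum_{s,m=1}^n c^m_{ms}\,(c^k_{sj}+c^j_{sk}),$$ $$\overset{3}{R}_{jk}=\frac14\sum_{s,m=1}^n c^j_{sm}c^k_{sm},\qquad \overset{4}{R}_{jk}=-\frac12\sum_{s,m=1}^n c^m_{sj}c^m_{sk}.$$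
   Context: A left invariant metric $g$ on $G$ is determined by the scalar product $\langle X,Y\rangle = g_p(X(p),Y(p))$ on $\mathfrak{g}$ (independent of $p\in G$). Let $\nabla$ be the Levi-Civita connection of $g$. The curvature convention is $\sum_l R^l_{ijk}E_l = \nabla_{E_i}\nabla_{E_j}E_k-\nabla_{E_j}\nabla_{E_i}E_k-\nabla_{[E_i,E_j]}E_k$, and the Ricci tensor is $R_{jk}=\sum_s R^s_{sjk}$. *)

theory Defs
  imports "HOL-Analysis.Analysis" "HOL-Library.Function_Algebras"
begin

text \<open>Functions into a real vector space, in particular tangent vectors (derivations) and vector
  fields, form a real vector space pointwise.\<close>

instantiation "fun" :: (type, real_vector) real_vector
begin

definition scaleR_fun :: "real \<Rightarrow> ('a \<Rightarrow> 'b) \<Rightarrow> 'a \<Rightarrow> 'b" where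
  "scaleR_fun c f = (\<lambda>x. c *\<^sub>R f x)"

instance
  by standard (simp_all add: scaleR_fun_def fun_eq_iff scaleR_add_right scaleR_add_left)

end

text \<open>Meant for open \<open>S\<close> and finite-dimensional domains: \<open>at x\<close> is not restricted to \<open>S\<close>.\<close>

primrec Ck_on :: "nat \<Rightarrow> 'a::real_normed_vector set \<Rightarrow> ('a \<Rightarrow> 'b::real_normed_vector) \<Rightarrow> bool" where
  "Ck_on 0 S f \<longleftrightarrow> continuous_on S f"
| "Ck_on (Suc k) S f \<longleftrightarrow> (\<forall>x\<in>S. f differentiable (at x)) \<and>
      (\<forall>v. Ck_on k S (\<lambda>x. frechet_derivative f (at x) v))"

definition smooth_on :: "'a::real_normed_vector set \<Rightarrow> ('a \<Rightarrow> 'b::real_normed_vector) \<Rightarrow> bool" where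
  "smooth_on S f \<longleftrightarrow> (\<forall>k. Ck_on k S f)"

text \<open>A manifold is a whole type with a (not necessarily maximal) smooth atlas; a chart is a domain
  together with a coordinate map that is relevant only on this domain.\<close>

type_synonym ('a, 'e) atlas = "('a set \<times> ('a \<Rightarrow> 'e)) set"

locale smooth_manifold =
  fixes A :: "('a::{t2_space, second_countable_topology}, 'e::euclidean_space) atlas"
  assumes charts: "(U, \<phi>) \<in> A \<Longrightarrow>
      open U \<and> open (\<phi> ` U) \<and> homeomorphism U (\<phi> ` U) \<phi> (inv_into U \<phi>)"
    and cover: "(\<Union>(U, \<phi>)\<in>A. U) = UNIV"
    and compatible: "(U, \<phi>) \<in> A \<Longrightarrow> (V, \<psi>) \<in> A \<Longrightarrow>
      smooth_on (\<phi> ` (U \<inter> V)) (\<psi> \<circ> inv_into U \<phi>)"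

definition smooth_map :: "('a::topological_space, 'e::real_normed_vector) atlas \<Rightarrow>
    ('b::topological_space, 'f::real_normed_vector) atlas \<Rightarrow> ('a \<Rightarrow> 'b) \<Rightarrow> bool" where
  "smooth_map A B F \<longleftrightarrow> continuous_on UNIV F \<and>
     (\<forall>(U, \<phi>)\<in>A. \<forall>(V, \<psi>)\<in>B. smooth_on (\<phi> ` (U \<inter> F -` V)) (\<psi> \<circ> F \<circ> inv_into U \<phi>))"

definition prod_atlas :: "('a, 'e) atlas \<Rightarrow> ('b, 'f) atlas \<Rightarrow> ('a \<times> 'b, 'e \<times> 'f) atlas" where
  "prod_atlas A B = {(U \<times> V, map_prod \<phi> \<psi>) |U \<phi> V \<psi>. (U, \<phi>) \<in> A \<and> (V, \<psi>) \<in> B}"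

definition smooth_fun :: "('a::topological_space, 'e::real_normed_vector) atlas \<Rightarrow> ('a \<Rightarrow> real) \<Rightarrow> bool" where
  "smooth_fun A f \<longleftrightarrow> smooth_map A {(UNIV, id)} f"

locale lie_group = smooth_manifold A + group mul e ginv
  for A :: "('a::{t2_space, second_countable_topology}, 'e::euclidean_space) atlas"
    and mul :: "'a \<Rightarrow> 'a \<Rightarrow> 'a" and e :: 'a and ginv :: "'a \<Rightarrow> 'a" +
  assumes smooth_mult: "smooth_map (prod_atlas A A) A (\<lambda>(x, y). mul x y)"
    and smooth_inv: "smooth_map A A ginv"

text \<open>Tangent vectors at a point are the derivations at that point of the algebra of smooth functions.
  They are represented by functionals on all real functions; to make the representation unique,
  they are required to vanish on non-smooth functions.\<close>

type_synonym 'a tangent = "('a \<Rightarrow> real) \<Rightarrow> real"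
type_synonym 'a vfield = "'a \<Rightarrow> 'a tangent"

definition tangent_space ::
    "('a::topological_space, 'e::real_normed_vector) atlas \<Rightarrow> 'a \<Rightarrow> 'a tangent set" where
  "tangent_space A p = {v.
     (\<forall>f. \<not> smooth_fun A f \<longrightarrow> v f = 0) \<and>
     (\<forall>f g. smooth_fun A f \<longrightarrow> smooth_fun A g \<longrightarrow> v (f + g) = v f + v g) \<and>
     (\<forall>c f. smooth_fun A f \<longrightarrow> v (c *\<^sub>R f) = c * v f) \<and>
     (\<forall>f g. smooth_fun A f \<longrightarrow> smooth_fun A g \<longrightarrow> v (f * g) = f p * v g + g p * v f)}"

definition vector_fields ::
    "('a::topological_space, 'e::real_normed_vector) atlas \<Rightarrow> 'a vfield set" where
  "vector_fields A = {X. (\<forall>p. X p \<in> tangent_space A p) \<and>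
     (\<forall>f. smooth_fun A f \<longrightarrow> smooth_fun A (\<lambda>p. X p f))}"

definition fun_scale :: "('a \<Rightarrow> real) \<Rightarrow> 'a vfield \<Rightarrow> 'a vfield" where
  "fun_scale f X = (\<lambda>p. f p *\<^sub>R X p)"

text \<open>No case distinction on the smoothness of \<open>f\<close> is needed here: for non-smooth \<open>f\<close> both inner
  functions are zero, and derivations annihilate the zero function.\<close>

definition lie_bracket :: "'a vfield \<Rightarrow> 'a vfield \<Rightarrow> 'a vfield" where
  "lie_bracket X Y = (\<lambda>p f. X p (\<lambda>q. Y q f) - Y p (\<lambda>q. X q f))"

text \<open>The differential of a smooth map \<open>F\<close> on tangent vectors; \<open>B\<close> is the atlas of the codomain.\<close>

definition push_forward :: "('b::topological_space, 'f::real_normed_vector) atlas \<Rightarrow>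
    ('a \<Rightarrow> 'b) \<Rightarrow> 'a tangent \<Rightarrow> 'b tangent" where
  "push_forward B F v = (\<lambda>f. if smooth_fun B f then v (f \<circ> F) else 0)"

definition left_invariant_fields :: "('a::topological_space, 'e::real_normed_vector) atlas \<Rightarrow>
    ('a \<Rightarrow> 'a \<Rightarrow> 'a) \<Rightarrow> 'a vfield set" where
  "left_invariant_fields A mul =
     {X \<in> vector_fields A. \<forall>a p. X (mul a p) = push_forward A (mul a) (X p)}"

text \<open>A metric \<open>g\<close> assigns to each point \<open>p\<close> a form \<open>g p\<close>, relevant only on the tangent space at \<open>p\<close>.\<close>

definition riemannian_metric :: "('a::topological_space, 'e::real_normed_vector) atlas \<Rightarrow>
    ('a \<Rightarrow> 'a tangent \<Rightarrow> 'a tangent \<Rightarrow> real) \<Rightarrow> bool" where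
  "riemannian_metric A g \<longleftrightarrow>
     (\<forall>p. \<forall>u\<in>tangent_space A p. \<forall>v\<in>tangent_space A p. g p u v = g p v u) \<and>
     (\<forall>p. \<forall>u\<in>tangent_space A p. \<forall>v\<in>tangent_space A p. \<forall>w\<in>tangent_space A p.
        g p (u + v) w = g p u w + g p v w) \<and>
     (\<forall>p c. \<forall>u\<in>tangent_space A p. \<forall>v\<in>tangent_space A p. g p (c *\<^sub>R u) v = c * g p u v) \<and>
     (\<forall>p. \<forall>u\<in>tangent_space A p. u \<noteq> 0 \<longrightarrow> g p u u > 0) \<and>
     (\<forall>X\<in>vector_fields A. \<forall>Y\<in>vector_fields A. smooth_fun A (\<lambda>p. g p (X p) (Y p)))"

definition left_invariant_metric :: "('a::topological_space, 'e::real_normed_vector) atlas \<Rightarrow>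
    ('a \<Rightarrow> 'a \<Rightarrow> 'a) \<Rightarrow> ('a \<Rightarrow> 'a tangent \<Rightarrow> 'a tangent \<Rightarrow> real) \<Rightarrow> bool" where
  "left_invariant_metric A mul g \<longleftrightarrow>
     (\<forall>a p. \<forall>u\<in>tangent_space A p. \<forall>v\<in>tangent_space A p.
        g (mul a p) (push_forward A (mul a) u) (push_forward A (mul a) v) = g p u v)"

text \<open>The scalar product on left invariant fields induced by a left invariant metric; evaluation at
  any other point gives the same value.\<close>

definition lie_scalar_product :: "('a \<Rightarrow> 'a tangent \<Rightarrow> 'a tangent \<Rightarrow> real) \<Rightarrow> 'a \<Rightarrow>
    'a vfield \<Rightarrow> 'a vfield \<Rightarrow> real" where
  "lie_scalar_product g e X Y = g e (X e) (Y e)"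

text \<open>Homogeneity of \<open>D\<close> over the reals in the second argument is the Leibniz rule for constant
  functions.\<close>

definition affine_connection :: "('a::topological_space, 'e::real_normed_vector) atlas \<Rightarrow>
    ('a vfield \<Rightarrow> 'a vfield \<Rightarrow> 'a vfield) \<Rightarrow> bool" where
  "affine_connection A D \<longleftrightarrow>
     (\<forall>X\<in>vector_fields A. \<forall>Y\<in>vector_fields A. D X Y \<in> vector_fields A) \<and>
     (\<forall>X\<in>vector_fields A. \<forall>Y\<in>vector_fields A. \<forall>Z\<in>vector_fields A.
        D (X + Y) Z = D X Z + D Y Z \<and> D X (Y + Z) = D X Y + D X Z) \<and>
     (\<forall>f. \<forall>X\<in>vector_fields A. \<forall>Y\<in>vector_fields A. smooth_fun A f \<longrightarrow>
        D (fun_scale f X) Y = fun_scale f (D X Y) \<and>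
        D X (fun_scale f Y) = fun_scale (\<lambda>p. X p f) Y + fun_scale f (D X Y))"

definition levi_civita :: "('a::topological_space, 'e::real_normed_vector) atlas \<Rightarrow>
    ('a \<Rightarrow> 'a tangent \<Rightarrow> 'a tangent \<Rightarrow> real) \<Rightarrow> ('a vfield \<Rightarrow> 'a vfield \<Rightarrow> 'a vfield) \<Rightarrow> bool" where
  "levi_civita A g D \<longleftrightarrow> affine_connection A D \<and>
     (\<forall>X\<in>vector_fields A. \<forall>Y\<in>vector_fields A. D X Y - D Y X = lie_bracket X Y) \<and>
     (\<forall>X\<in>vector_fields A. \<forall>Y\<in>vector_fields A. \<forall>Z\<in>vector_fields A. \<forall>p.
        X p (\<lambda>q. g q (Y q) (Z q)) = g p (D X Y p) (Z p) + g p (Y p) (D X Z p))"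

definition curvature :: "('a vfield \<Rightarrow> 'a vfield \<Rightarrow> 'a vfield) \<Rightarrow>
    'a vfield \<Rightarrow> 'a vfield \<Rightarrow> 'a vfield \<Rightarrow> 'a vfield" where
  "curvature D X Y Z = D X (D Y Z) - D Y (D X Z) - D (lie_bracket X Y) Z"

text \<open>For a frame \<open>E\<close>, \<open>curvature_coord D E p l i j k\<close> is the coordinate of index \<open>l\<close> (upper) and
  \<open>i j k\<close> (lower) of the curvature tensor at \<open>p\<close>: the \<open>l\<close>-th coefficient of the value at \<open>p\<close> of
  \<open>curvature D (E i) (E j) (E k)\<close> in the basis of the tangent space given by the \<open>E m p\<close>.\<close>

definition curvature_coord :: "('a vfield \<Rightarrow> 'a vfield \<Rightarrow> 'a vfield) \<Rightarrow> ('i \<Rightarrow> 'a vfield) \<Rightarrow>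
    'a \<Rightarrow> 'i \<Rightarrow> 'i \<Rightarrow> 'i \<Rightarrow> 'i \<Rightarrow> real" where
  "curvature_coord D E p l i j k =
     representation (range (\<lambda>m. E m p)) (curvature D (E i) (E j) (E k) p) (E l p)"

definition ricci_coord :: "('a vfield \<Rightarrow> 'a vfield \<Rightarrow> 'a vfield) \<Rightarrow> ('i::finite \<Rightarrow> 'a vfield) \<Rightarrow>
    'a \<Rightarrow> 'i \<Rightarrow> 'i \<Rightarrow> real" where
  "ricci_coord D E p j k = (\<Sum>s\<in>UNIV. curvature_coord D E p s s j k)"

end

theory Submission
  imports Defs
begin

text \<open>By the Koszul formula the Levi-Civita connection is natural under left translations of arbitrary
  vector fields, so \<open>D X Y\<close> is left invariant whenever \<open>X\<close> and \<open>Y\<close> are. Hence \<open>D (E i) (E j)\<close> lies in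
  the span of the frame, and no bound on the dimension of the space of derivations at a point is
  needed. Its coefficients are read off the Koszul formula, in which all derivative terms vanish:
  \<open>\<Gamma> k i j = (c k i j - c i j k - c j i k) / 2\<close>. The Ricci coordinates become a quadratic polynomial in
  the structure constants; it reduces to the claimed one because \<open>ad [E j, E k]\<close>, being a commutator
  by the Jacobi identity, has trace zero.\<close>

section \<open>Calculus of \<open>Ck_on\<close>\<close>

text \<open>\<open>frechet_derivative\<close> is taken at unrestricted points, so derivatives
  transfer only because openness of \<open>S\<close> makes \<open>f\<close> and \<open>g\<close>
  agree near each point.\<close>

lemma Ck_on_cong:
  assumes "open S" "Ck_on k S f" "\<And>x. x \<in> S \<Longrightarrow> f x = g x"
  shows "Ck_on k S g"
  using assms(2,3)
proof (induction k arbitrary: f g)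
  case 0
  then show ?case by (simp cong: continuous_on_cong)
next
  case (Suc k)
  have g: "(g has_derivative frechet_derivative f (at x)) (at x)" if "x \<in> S" for x
    using Suc.prems(1) that
    by (intro has_derivative_transform_within_open[OF _ \<open>open S\<close> that Suc.prems(2)])
      (simp_all add: frechet_derivative_works[symmetric])
  have "Ck_on k S (\<lambda>x. frechet_derivative g (at x) v)" for v
  proof (rule Suc.IH)
    show "Ck_on k S (\<lambda>x. frechet_derivative f (at x) v)"
      using Suc.prems(1) by simp
  qed (simp add: frechet_derivative_at[OF g, symmetric])
  with g show ?case unfolding Ck_on.simps differentiable_def by blast
qed

text \<open>Uniqueness of derivatives lets any explicit \<open>f'\<close> replace the one chosen by
  \<open>frechet_derivative\<close>.\<close>

lemma Ck_on_SucI: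
  assumes "open S" "\<And>x. x \<in> S \<Longrightarrow> (f has_derivative f' x) (at x)"
    and "\<And>v. Ck_on k S (\<lambda>x. f' x v)"
  shows "Ck_on (Suc k) S f"
proof -
  have "Ck_on k S (\<lambda>x. frechet_derivative f (at x) v)" for v
    using assms(1) assms(3)[of v] by (rule Ck_on_cong) (simp add: frechet_derivative_at[OF assms(2)])
  with assms(2) show ?thesis unfolding Ck_on.simps differentiable_def by blast
qed

lemma Ck_on_has_derivative:
  assumes "Ck_on (Suc k) S f" "x \<in> S"
  shows "(f has_derivative frechet_derivative f (at x)) (at x)"
  using assms by (simp add: frechet_derivative_works[symmetric])

lemma Ck_on_Suc_imp: "Ck_on (Suc k) S f \<Longrightarrow> Ck_on k S f"
proof (induction k arbitrary: f)
  case 0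
  then show ?case
    by (auto intro!: continuous_at_imp_continuous_on differentiable_imp_continuous_within)
qed auto

lemma Ck_on_const: "open S \<Longrightarrow> Ck_on k S (\<lambda>x. c)"
proof (induction k arbitrary: c)
  case (Suc k)
  then show ?case
    by (intro Ck_on_SucI[where f' = "\<lambda>x v. 0"]) auto
qed simp

text \<open>Fixing the first coordinate will turn smoothness of multiplication in two variables into
  smoothness of a left translation.\<close>

lemma Ck_on_Pair_right:
  assumes "open S"
  shows "Ck_on k S (Pair c)"
proof (cases k)
  case 0
  then show ?thesis by (simp add: continuous_on_Pair)
next
  case (Suc m)
  have "(Pair c has_derivative (\<lambda>v. (0, v))) (at x)" for x
    by (intro has_derivative_Pair has_derivative_const has_derivative_ident)
  then show ?thesis
    unfolding Suc by (intro Ck_on_SucI[where f' = "\<lambda>x v. (0, v)"] Ck_on_const assms)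
qed

lemma Ck_on_add:
  assumes "open S" "Ck_on k S f" "Ck_on k S g"
  shows "Ck_on k S (\<lambda>x. f x + g x)"
  using assms(2,3)
proof (induction k arbitrary: f g)
  case (Suc k)
  show ?case
  proof (rule Ck_on_SucI[OF \<open>open S\<close>])
    show "((\<lambda>x. f x + g x) has_derivative
        (\<lambda>v. frechet_derivative f (at x) v + frechet_derivative g (at x) v)) (at x)" if "x \<in> S" for x
      using Suc.prems that by (intro has_derivative_add Ck_on_has_derivative)
  qed (use Suc in auto)
qed (auto intro: continuous_on_add)

lemma Ck_on_sum:
  assumes "open S" "finite I" "\<And>i. i \<in> I \<Longrightarrow> Ck_on k S (f i)"
  shows "Ck_on k S (\<lambda>x. \<Sum>i\<in>I. f i x)"
  using assms(2,3) by induction (auto intro: Ck_on_const Ck_on_add \<open>open S\<close>)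

lemma Ck_on_scaleR:
  fixes f :: "_ \<Rightarrow> real"
  assumes "open S" "Ck_on k S f" "Ck_on k S g"
  shows "Ck_on k S (\<lambda>x. f x *\<^sub>R g x)"
  using assms(2,3)
proof (induction k arbitrary: f g)
  case (Suc k)
  show ?case
  proof (rule Ck_on_SucI[OF \<open>open S\<close>])
    show "((\<lambda>x. f x *\<^sub>R g x) has_derivative
        (\<lambda>v. f x *\<^sub>R frechet_derivative g (at x) v + frechet_derivative f (at x) v *\<^sub>R g x)) (at x)"
      if "x \<in> S" for x
      using Suc.prems that by (intro has_derivative_scaleR Ck_on_has_derivative)
    show "Ck_on k S (\<lambda>x. f x *\<^sub>R frechet_derivative g (at x) v + frechet_derivative f (at x) v *\<^sub>R g x)" for v
      using Suc.prems Ck_on_Suc_imp[OF Suc.prems(1)] Ck_on_Suc_imp[OF Suc.prems(2)]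
      by (intro Ck_on_add Suc.IH \<open>open S\<close>) auto
  qed
qed (auto intro: continuous_on_scaleR)

lemma Ck_on_inner_left:
  assumes "open S" "Ck_on k S f"
  shows "Ck_on k S (\<lambda>x. f x \<bullet> b)"
  using assms(2)
proof (induction k arbitrary: f)
  case (Suc k)
  show ?case
  proof (rule Ck_on_SucI[OF \<open>open S\<close>])
    show "((\<lambda>x. f x \<bullet> b) has_derivative (\<lambda>v. frechet_derivative f (at x) v \<bullet> b)) (at x)"
      if "x \<in> S" for x
      using Suc.prems that by (intro has_derivative_inner_left Ck_on_has_derivative)
  qed (use Suc in auto)
qed (auto intro!: continuous_intros)

text \<open>In the chain rule the direction fed to the derivative of \<open>g\<close> varies with
  \<open>x\<close>, while \<open>Ck_on\<close> controls fixed directions only. Expanding the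
  direction in \<open>Basis\<close> gives a finite sum of products; the induction hypothesis then
  applies with the same \<open>f\<close> and with \<open>g\<close> replaced by its partial
  derivatives.\<close>

lemma Ck_on_compose:
  fixes f :: "'a::real_normed_vector \<Rightarrow> 'b::euclidean_space" and g :: "'b \<Rightarrow> 'c::real_normed_vector"
  assumes "open S" "Ck_on k S f" "Ck_on k T g" "f ` S \<subseteq> T"
  shows "Ck_on k S (g \<circ> f)"
  using assms(2-4)
proof (induction k arbitrary: g)
  case 0
  then show ?case
    using continuous_on_compose continuous_on_subset by (metis Ck_on.simps(1))
next
  case (Suc k)
  show ?case
  proof (rule Ck_on_SucI[OF \<open>open S\<close>])
    fix x assume x: "x \<in> S"
    let ?f' = "frechet_derivative f (at x)" and ?g' = "frechet_derivative g (at (f x))"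
    have g': "(g has_derivative ?g') (at (f x))"
      using Suc.prems x by (blast intro: Ck_on_has_derivative)
    have "?g' w = (\<Sum>b\<in>Basis. (w \<bullet> b) *\<^sub>R ?g' b)" for w
      using linear_sum[of ?g' "\<lambda>b. (w \<bullet> b) *\<^sub>R b" Basis] has_derivative_linear[OF g']
      by (simp add: euclidean_representation linear_scale)
    then have "?g' \<circ> ?f' = (\<lambda>v. \<Sum>b\<in>Basis. (?f' v \<bullet> b) *\<^sub>R ?g' b)"
      unfolding comp_def by (intro ext)
    with diff_chain_at[OF Ck_on_has_derivative[OF Suc.prems(1) x] g']
    show "(g \<circ> f has_derivative (\<lambda>v. \<Sum>b\<in>Basis. (?f' v \<bullet> b) *\<^sub>R ?g' b)) (at x)"
      by simp
  next
    show "Ck_on k S (\<lambda>x. \<Sum>b\<in>Basis. (frechet_derivative f (at x) v \<bullet> b) *\<^sub>R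
        frechet_derivative g (at (f x)) b)" for v
      using Suc.prems Ck_on_Suc_imp[OF Suc.prems(1)] Suc.IH[of "\<lambda>y. frechet_derivative g (at y) _"]
      by (intro Ck_on_sum Ck_on_scaleR Ck_on_inner_left \<open>open S\<close>) (auto simp: comp_def)
  qed
qed

text \<open>The derivative at a point does not depend on the neighbourhood, so different charts may
  be used near different points.\<close>

lemma Ck_on_local:
  assumes "\<And>x. x \<in> S \<Longrightarrow> \<exists>T. open T \<and> x \<in> T \<and> Ck_on k T f"
  shows "Ck_on k S f"
  using assms
proof (induction k arbitrary: f)
  case 0
  then show ?case
    by (metis Ck_on.simps(1) continuous_at_imp_continuous_on continuous_on_eq_continuous_at)
next
  case (Suc k)
  have "f differentiable at x" if "x \<in> S" for x
    using Suc.prems[OF that] by auto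
  moreover have "Ck_on k S (\<lambda>x. frechet_derivative f (at x) v)" for v
  proof (rule Suc.IH)
    show "\<exists>T. open T \<and> x \<in> T \<and> Ck_on k T (\<lambda>x. frechet_derivative f (at x) v)" if "x \<in> S" for x
      using Suc.prems[OF that] by auto
  qed
  ultimately show ?case by simp
qed

section \<open>Smooth functions and left translations\<close>

lemma smooth_fun_iff:
  "smooth_fun A f \<longleftrightarrow>
    continuous_on UNIV f \<and> (\<forall>(U, \<phi>)\<in>A. smooth_on (\<phi> ` U) (f \<circ> inv_into U \<phi>))"
  by (simp add: smooth_fun_def smooth_map_def)

context smooth_manifold
begin

lemma chart_open_image: "(U, \<phi>) \<in> A \<Longrightarrow> open (\<phi> ` U)"
  using charts by blast

lemma chart_inj_on:
  assumes "(U, \<phi>) \<in> A"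
  shows "inj_on \<phi> U"
proof (rule inj_on_inverseI)
  show "inv_into U \<phi> (\<phi> p) = p" if "p \<in> U" for p
    using charts[OF assms] that by (simp add: homeomorphism_def)
qed

lemma obtain_chart:
  obtains U \<phi> where "(U, \<phi>) \<in> A" "p \<in> U"
proof -
  have "p \<in> (\<Union>(U, \<phi>)\<in>A. U)"
    unfolding cover by simp
  then show ?thesis using that by auto
qed

lemma smooth_fun_const: "smooth_fun A (\<lambda>p. c)"
  unfolding smooth_fun_iff smooth_on_def
  by (auto simp: comp_def intro!: Ck_on_const chart_open_image)

lemma smooth_fun_add:
  assumes "smooth_fun A f" "smooth_fun A h"
  shows "smooth_fun A (\<lambda>p. f p + h p)"
  using assms unfolding smooth_fun_iff smooth_on_def
  by (fastforce simp: comp_def intro!: Ck_on_add chart_open_image continuous_on_add)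

lemma smooth_fun_scale:
  assumes "smooth_fun A f"
  shows "smooth_fun A (\<lambda>p. c * f p)"
proof -
  have "Ck_on k (\<phi> ` U) (\<lambda>x. c *\<^sub>R f (inv_into U \<phi> x))" if "(U, \<phi>) \<in> A" for U \<phi> k
    using assms that unfolding smooth_fun_iff smooth_on_def
    by (intro Ck_on_scaleR Ck_on_const chart_open_image) (auto simp: comp_def)
  with assms show ?thesis
    unfolding smooth_fun_iff smooth_on_def by (auto simp: comp_def intro: continuous_intros)
qed

end

context lie_group
begin

lemma continuous_left_translation: "continuous_on S (mul a)"
proof -
  have "continuous_on UNIV (case_prod mul)"
    using smooth_mult unfolding smooth_map_def by (simp add: case_prod_unfold)
  then have "continuous_on UNIV (case_prod mul \<circ> Pair a)"
    by (intro continuous_on_compose) (auto intro: continuous_intros continuous_on_subset)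
  then show ?thesis
    by (auto simp: comp_def intro: continuous_on_subset)
qed

text \<open>Near each point, \<open>f \<circ> mul a\<close> in coordinates is a composite of three
  maps: insertion of the coordinates of \<open>a\<close>, multiplication in charts, and
  \<open>f\<close> in a chart around the product.\<close>

lemma smooth_fun_left_translation:
  assumes f: "smooth_fun A f"
  shows "smooth_fun A (f \<circ> mul a)"
proof -
  have "Ck_on k (\<phi> ` U) (f \<circ> mul a \<circ> inv_into U \<phi>)" if U: "(U, \<phi>) \<in> A" for U \<phi> k
  proof (rule Ck_on_local)
    fix x assume "x \<in> \<phi> ` U"
    then obtain p where p: "p \<in> U" "x = \<phi> p" by blast
    obtain W \<theta> where W: "(W, \<theta>) \<in> A" "a \<in> W" using obtain_chart by blast
    obtain V \<psi> where V: "(V, \<psi>) \<in> A" "mul a p \<in> V" using obtain_chart by blast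
    define T where "T = \<phi> ` (U \<inter> mul a -` V)"
    note injU = chart_inj_on[OF U] and injV = chart_inj_on[OF V(1)]
    have inj: "inj_on (map_prod \<theta> \<phi>) (W \<times> U)"
      using chart_inj_on[OF W(1)] injU by (rule map_prod_inj_on)
    have "open (mul a -` V)"
      using charts[OF V(1)] continuous_left_translation[of UNIV a] open_vimage by blast
    then have "openin (top_of_set U) (U \<inter> mul a -` V)"
      by (auto simp: openin_open)
    then have "openin (top_of_set (\<phi> ` U)) T"
      unfolding T_def using charts[OF U] homeomorphism_imp_open_map by blast
    then have T: "open T"
      using chart_open_image[OF U] openin_open_trans by blast
    \<comment> \<open>\<open>?m\<close> is multiplication in charts with domain \<open>?S\<close>,
      which contains \<open>T\<close> as part of the slice over \<open>\<theta> a\<close>.\<close>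
    let ?m = "\<psi> \<circ> (\<lambda>(x, y). mul x y) \<circ> inv_into (W \<times> U) (map_prod \<theta> \<phi>)"
    let ?S = "map_prod \<theta> \<phi> ` ((W \<times> U) \<inter> (\<lambda>(x, y). mul x y) -` V)"
    have inv: "inv_into (W \<times> U) (map_prod \<theta> \<phi>) (\<theta> a, \<phi> q) = (a, q)" if "q \<in> U" for q
      using inv_into_f_f[OF inj, of "(a, q)"] W(2) that by simp
    have "(W \<times> U, map_prod \<theta> \<phi>) \<in> prod_atlas A A"
      using U W unfolding prod_atlas_def by blast
    then have "Ck_on k ?S ?m"
      using smooth_mult V(1) unfolding smooth_map_def smooth_on_def by blast
    moreover have "Pair (\<theta> a) ` T \<subseteq> ?S"
      using W(2) unfolding T_def by force
    ultimately have "Ck_on k T (?m \<circ> Pair (\<theta> a))"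
      using T by (intro Ck_on_compose Ck_on_Pair_right)
    moreover have "(?m \<circ> Pair (\<theta> a)) ` T \<subseteq> \<psi> ` V"
      unfolding T_def by (auto simp: inv)
    moreover have "Ck_on k (\<psi> ` V) (f \<circ> inv_into V \<psi>)"
      using f V(1) unfolding smooth_fun_iff smooth_on_def by blast
    ultimately have "Ck_on k T ((f \<circ> inv_into V \<psi>) \<circ> (?m \<circ> Pair (\<theta> a)))"
      using T by - (rule Ck_on_compose)
    then have "Ck_on k T (f \<circ> mul a \<circ> inv_into U \<phi>)"
      by (rule Ck_on_cong[OF T]) (auto simp: T_def inv inv_into_f_f[OF injU] inv_into_f_f[OF injV])
    moreover have "x \<in> T"
      using p V(2) unfolding T_def by blast
    ultimately show "\<exists>T. open T \<and> x \<in> T \<and> Ck_on k T (f \<circ> mul a \<circ> inv_into U \<phi>)"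
      using T by blast
  qed
  moreover have "continuous_on UNIV (f \<circ> mul a)"
    using f unfolding smooth_fun_iff
    by (intro continuous_on_compose continuous_left_translation) (auto intro: continuous_on_subset)
  ultimately show ?thesis
    unfolding smooth_fun_iff smooth_on_def by blast
qed

end

section \<open>Vector fields under left translation\<close>

context smooth_manifold
begin

section \<open>Derivations at a point, vector fields and the Jacobi identity\<close>

lemma tangent_nonsmooth: "v \<in> tangent_space A p \<Longrightarrow> \<not> smooth_fun A f \<Longrightarrow> v f = 0"
  unfolding tangent_space_def by blast

lemma tangent_add:
  assumes "v \<in> tangent_space A p" "smooth_fun A f" "smooth_fun A h"
  shows "v (\<lambda>x. f x + h x) = v f + v h"
proof -
  have "v (f + h) = v f + v h"
    using assms unfolding tangent_space_def by blast
  then show ?thesis by (simp add: plus_fun_def)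
qed

lemma tangent_scale:
  assumes "v \<in> tangent_space A p" "smooth_fun A f"
  shows "v (\<lambda>x. c * f x) = c * v f"
proof -
  have "v (c *\<^sub>R f) = c * v f"
    using assms unfolding tangent_space_def by blast
  then show ?thesis by (simp add: scaleR_fun_def)
qed

lemma tangent_diff:
  assumes "v \<in> tangent_space A p" "smooth_fun A f" "smooth_fun A h"
  shows "v (\<lambda>x. f x - h x) = v f - v h"
  using tangent_add[OF assms(1,2) smooth_fun_scale[OF assms(3), of "-1"]]
    tangent_scale[OF assms(1,3), of "-1"] by simp

lemma tangent_const:
  assumes "v \<in> tangent_space A p"
  shows "v (\<lambda>x. c) = 0"
proof -
  \<comment> \<open>The Leibniz rule for \<open>1 = 1 * 1\<close> makes the value of
    \<open>v\<close> at 1 equal to twice itself.\<close>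
  have "v ((\<lambda>x. 1) * (\<lambda>x. 1)) = 1 * v (\<lambda>x. 1) + 1 * v (\<lambda>x. 1)"
    using assms smooth_fun_const unfolding tangent_space_def by blast
  then have "v (\<lambda>x. 1) = 0" by (simp add: times_fun_def)
  then show ?thesis
    using tangent_scale[OF assms smooth_fun_const, of c 1] by simp
qed

lemma subspace_tangent_space: "subspace (tangent_space A p)"
proof (rule subspaceI)
  show "0 \<in> tangent_space A p"
    unfolding tangent_space_def by simp
  show "u + v \<in> tangent_space A p" if "u \<in> tangent_space A p" "v \<in> tangent_space A p" for u v
    using that unfolding tangent_space_def by (simp add: algebra_simps)
  show "c *\<^sub>R v \<in> tangent_space A p" if "v \<in> tangent_space A p" for c v
    using that unfolding tangent_space_def by (simp add: scaleR_fun_def algebra_simps)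
qed

lemma vector_field_tangent: "X \<in> vector_fields A \<Longrightarrow> X p \<in> tangent_space A p"
  unfolding vector_fields_def by blast

text \<open>For non-smooth \<open>f\<close> the function is zero. Covering every \<open>f\<close>
  keeps later rewriting free of side conditions.\<close>

lemma vector_field_smooth:
  assumes "X \<in> vector_fields A"
  shows "smooth_fun A (\<lambda>p. X p f)"
proof (cases "smooth_fun A f")
  case True
  then show ?thesis using assms unfolding vector_fields_def by blast
next
  case False
  then show ?thesis
    using tangent_nonsmooth[OF vector_field_tangent[OF assms]] smooth_fun_const by simp
qed

lemma subspace_vector_fields: "subspace (vector_fields A)"
proof (rule subspaceI)
  show "0 \<in> vector_fields A"
    unfolding vector_fields_def using subspace_0[OF subspace_tangent_space] smooth_fun_const by simp
  show "X + Y \<in> vector_fields A" if "X \<in> vector_fields A" "Y \<in> vector_fields A" for X Y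
    using that unfolding vector_fields_def
    by (simp add: subspace_add[OF subspace_tangent_space] smooth_fun_add)
  show "c *\<^sub>R X \<in> vector_fields A" if "X \<in> vector_fields A" for c X
    using that smooth_fun_scale unfolding vector_fields_def
    by (simp add: scaleR_fun_def[of c X] subspace_scale[OF subspace_tangent_space])
      (simp add: scaleR_fun_def)
qed

lemma vector_field_nonsmooth:
  assumes "X \<in> vector_fields A" "\<not> smooth_fun A f"
  shows "X p f = 0"
  using assms tangent_nonsmooth vector_field_tangent by blast

lemma lie_bracket_nonsmooth:
  assumes "X \<in> vector_fields A" "Y \<in> vector_fields A" "\<not> smooth_fun A f"
  shows "lie_bracket X Y p f = 0"
  using assms unfolding lie_bracket_def
  by (simp add: vector_field_nonsmooth tangent_const[OF vector_field_tangent])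

text \<open>Applied to \<open>f\<close>, the double brackets expand by linearity of derivations into
  twelve terms that cancel in pairs. Linearity requires smooth inner functions, which
  \<open>vector_field_smooth\<close> supplies for every \<open>f\<close>.\<close>

lemma lie_bracket_jacobi:
  assumes X: "X \<in> vector_fields A" and Y: "Y \<in> vector_fields A" and Z: "Z \<in> vector_fields A"
  shows "lie_bracket X (lie_bracket Y Z) + lie_bracket Y (lie_bracket Z X)
    + lie_bracket Z (lie_bracket X Y) = 0"
proof (intro ext)
  fix p f
  show "(lie_bracket X (lie_bracket Y Z) + lie_bracket Y (lie_bracket Z X)
    + lie_bracket Z (lie_bracket X Y)) p f = 0 p f"
    using assms
    by (simp add: lie_bracket_def vector_field_smooth tangent_diff[OF vector_field_tangent[OF X]]
        tangent_diff[OF vector_field_tangent[OF Y]] tangent_diff[OF vector_field_tangent[OF Z]])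
qed

end

lemma lie_bracket_anti: "lie_bracket Y X = - lie_bracket X Y"
  by (simp add: lie_bracket_def fun_eq_iff)

context lie_group
begin

section \<open>Push-forward by left translations and related fields\<close>

abbreviation "push a \<equiv> push_forward A (mul a)"

text \<open>The usual relatedness of fields under the diffeomorphism \<open>mul a\<close>. Left
  invariance is relatedness to itself; two separate fields are allowed so that naturality of
  \<open>D\<close> can be stated for arbitrary ones.\<close>

definition translation_related :: "'a \<Rightarrow> 'a vfield \<Rightarrow> 'a vfield \<Rightarrow> bool" where
  "translation_related a X X' \<longleftrightarrow> (\<forall>p. X' (mul a p) = push a (X p))"

definition translate :: "'a \<Rightarrow> 'a vfield \<Rightarrow> 'a vfield" where
  "translate a X = (\<lambda>p. push a (X (mul (ginv a) p)))"

lemma mul_ginv_cancel: "mul (ginv a) (mul a p) = p" "mul a (mul (ginv a) p) = p"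
  by (simp_all flip: assoc)

lemma left_invariant_iff:
  "X \<in> left_invariant_fields A mul \<longleftrightarrow>
    X \<in> vector_fields A \<and> (\<forall>a. translation_related a X X)"
  by (simp add: left_invariant_fields_def translation_related_def)

lemma push_smooth: "smooth_fun A f \<Longrightarrow> push a v f = v (f \<circ> mul a)"
  by (simp add: push_forward_def)

text \<open>Translation by \<open>ginv a\<close> is inverse to \<open>mul a\<close>, so composition
  with \<open>mul a\<close> preserves and reflects smoothness. Hence \<open>push a v\<close> is
  precomposition on all functions, and the derivation laws carry over.\<close>

lemma push_in_tangent_space:
  assumes "v \<in> tangent_space A p"
  shows "push a v \<in> tangent_space A (mul a p)"
proof -
  have comp: "(f + h) \<circ> mul a = (f \<circ> mul a) + (h \<circ> mul a)"
    "(f * h) \<circ> mul a = (f \<circ> mul a) * (h \<circ> mul a)"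
    "(c *\<^sub>R f) \<circ> mul a = c *\<^sub>R (f \<circ> mul a)" for f h :: "'a \<Rightarrow> real" and c
    by (simp_all add: fun_eq_iff scaleR_fun_def)
  have nonsmooth: "v f = 0" if "\<not> smooth_fun A f" for f
    using assms that by (rule tangent_nonsmooth)
  have add: "v (f + h) = v f + v h" if "smooth_fun A f" "smooth_fun A h" for f h
    using assms that unfolding tangent_space_def by blast
  have scale: "v (c *\<^sub>R f) = c * v f" if "smooth_fun A f" for c f
    using assms that unfolding tangent_space_def by blast
  have product: "v (f * h) = f p * v h + h p * v f" if "smooth_fun A f" "smooth_fun A h" for f h
    using assms that unfolding tangent_space_def by blast
  have smooth_iff: "smooth_fun A (f \<circ> mul a) \<longleftrightarrow> smooth_fun A f" for f
    using smooth_fun_left_translation[of f a] smooth_fun_left_translation[of "f \<circ> mul a" "ginv a"]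
    by (auto simp: comp_def mul_ginv_cancel)
  have push: "push a v f = v (f \<circ> mul a)" for f
    by (simp add: push_forward_def nonsmooth smooth_iff)
  show ?thesis
    unfolding tangent_space_def push mem_Collect_eq comp
    by (simp add: smooth_iff nonsmooth add scale product)
qed

lemma push_push_ginv:
  assumes "v \<in> tangent_space A p"
  shows "push a (push (ginv a) v) = v"
proof
  show "push a (push (ginv a) v) f = v f" for f
    using tangent_nonsmooth[OF assms] smooth_fun_left_translation[of f a]
    by (cases "smooth_fun A f") (simp_all add: push_forward_def comp_def mul_ginv_cancel)
qed

lemma translate_in_vector_fields:
  assumes "X \<in> vector_fields A"
  shows "translate a X \<in> vector_fields A"
proof -
  have "translate a X p \<in> tangent_space A p" for p
    using push_in_tangent_space[OF vector_field_tangent[OF assms, of "mul (ginv a) p"], of a]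
    by (simp add: translate_def mul_ginv_cancel)
  moreover have "smooth_fun A (\<lambda>p. translate a X p f)" if "smooth_fun A f" for f
    using smooth_fun_left_translation[OF vector_field_smooth[OF assms], of "f \<circ> mul a" "ginv a"] that
    by (simp add: translate_def push_forward_def comp_def)
  ultimately show ?thesis unfolding vector_fields_def by blast
qed

lemma translation_related_translate: "translation_related a X (translate a X)"
  by (simp add: translation_related_def translate_def mul_ginv_cancel)


text \<open>Pulls a prescribed field back, so that test fields can be chosen on the target
  side.\<close>

lemma translate_related:
  assumes "X \<in> vector_fields A"
  shows "translation_related a (translate (ginv a) X) X"
  using push_push_ginv[OF vector_field_tangent[OF assms]]
  by (simp add: translation_related_def translate_def mul_ginv_cancel)

lemma derivative_related:
  assumes "translation_related a X X'" "smooth_fun A f"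
  shows "X' (mul a p) f = X p (f \<circ> mul a)"
  using assms by (simp add: translation_related_def push_smooth)

text \<open>Relatedness is used for the inner derivative of \<open>f\<close> and then for the outer
  derivative of the resulting smooth function. For non-smooth \<open>f\<close> both sides are
  zero.\<close>

lemma lie_bracket_related:
  assumes "X \<in> vector_fields A" "Y \<in> vector_fields A" "X' \<in> vector_fields A" "Y' \<in> vector_fields A"
    and XX': "translation_related a X X'" and YY': "translation_related a Y Y'"
  shows "translation_related a (lie_bracket X Y) (lie_bracket X' Y')"
  unfolding translation_related_def
proof (intro allI ext)
  fix p f
  show "lie_bracket X' Y' (mul a p) f = push a (lie_bracket X Y p) f"
  proof (cases "smooth_fun A f")
    case True
    then show ?thesis
      using assms(1-4)
      by (simp add: lie_bracket_def push_smooth comp_def vector_field_smooth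
          derivative_related[OF XX'] derivative_related[OF YY'])
  next
    case False
    then show ?thesis
      using assms lie_bracket_nonsmooth by (simp add: push_forward_def)
  qed
qed

end

section \<open>The Levi-Civita connection of a left invariant metric\<close>

locale lie_group_levi_civita = lie_group A mul e ginv
  for A :: "('a::{t2_space, second_countable_topology}, 'e::euclidean_space) atlas"
    and mul :: "'a \<Rightarrow> 'a \<Rightarrow> 'a" and e :: 'a and ginv :: "'a \<Rightarrow> 'a" +
  fixes g :: "'a \<Rightarrow> 'a tangent \<Rightarrow> 'a tangent \<Rightarrow> real"
    and D :: "'a vfield \<Rightarrow> 'a vfield \<Rightarrow> 'a vfield"
  assumes metric: "riemannian_metric A g"
    and metric_invariant: "left_invariant_metric A mul g"
    and connection: "levi_civita A g D"
begin

section \<open>Real linearity of metric and connection, and the Koszul formula\<close>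

lemma metric_sym: "u \<in> tangent_space A p \<Longrightarrow> v \<in> tangent_space A p \<Longrightarrow> g p u v = g p v u"
  using metric unfolding riemannian_metric_def by blast

lemma metric_add_left:
  assumes "u \<in> tangent_space A p" "v \<in> tangent_space A p" "w \<in> tangent_space A p"
  shows "g p (u + v) w = g p u w + g p v w"
  using metric assms unfolding riemannian_metric_def by blast

lemma metric_scale_left:
  assumes "u \<in> tangent_space A p" "v \<in> tangent_space A p"
  shows "g p (c *\<^sub>R u) v = c * g p u v"
  using metric assms unfolding riemannian_metric_def by blast

lemma metric_pos: "u \<in> tangent_space A p \<Longrightarrow> u \<noteq> 0 \<Longrightarrow> g p u u > 0"
  using metric unfolding riemannian_metric_def by blast

lemma metric_smooth:
  "X \<in> vector_fields A \<Longrightarrow> Y \<in> vector_fields A \<Longrightarrow> smooth_fun A (\<lambda>p. g p (X p) (Y p))"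
  using metric unfolding riemannian_metric_def by blast

lemma metric_diff_left:
  assumes "u \<in> tangent_space A p" "v \<in> tangent_space A p" "w \<in> tangent_space A p"
  shows "g p (u - v) w = g p u w - g p v w"
  using metric_add_left[OF subspace_diff[OF subspace_tangent_space assms(1,2)] assms(2,3)] by simp

text \<open>Additivity of \<open>g p\<close> is given on tangent vectors only, so the induction
  carries membership of the partial sums in the tangent space.\<close>

lemma metric_sum_left:
  assumes "\<And>i. i \<in> I \<Longrightarrow> u i \<in> tangent_space A p" "w \<in> tangent_space A p"
  shows "g p (\<Sum>i\<in>I. c i *\<^sub>R u i) w = (\<Sum>i\<in>I. c i * g p (u i) w)"
proof -
  have zero: "g p 0 w = 0"
    using metric_scale_left[OF assms(2,2), of 0] by simp
  show ?thesis
    using assms(1)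
  proof (induction I rule: infinite_finite_induct)
    case (insert i I)
    have "g p (c i *\<^sub>R u i + (\<Sum>i\<in>I. c i *\<^sub>R u i)) w
        = g p (c i *\<^sub>R u i) w + g p (\<Sum>i\<in>I. c i *\<^sub>R u i) w"
      by (intro metric_add_left subspace_sum subspace_scale subspace_tangent_space assms(2) insert.prems) auto
    moreover have "g p (\<Sum>i\<in>I. c i *\<^sub>R u i) w = (\<Sum>i\<in>I. c i * g p (u i) w)"
      by (intro insert.IH insert.prems) simp
    moreover have "g p (c i *\<^sub>R u i) w = c i * g p (u i) w"
      by (intro metric_scale_left assms(2) insert.prems) simp
    ultimately show ?case
      by (simp only: sum.insert[OF insert.hyps])
  qed (simp_all add: zero)
qed

lemma metric_push:
  assumes "u \<in> tangent_space A p" "v \<in> tangent_space A p"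
  shows "g (mul a p) (push a u) (push a v) = g p u v"
  using metric_invariant assms unfolding left_invariant_metric_def by blast

lemma connection_vector_field:
  "X \<in> vector_fields A \<Longrightarrow> Y \<in> vector_fields A \<Longrightarrow> D X Y \<in> vector_fields A"
  using connection unfolding levi_civita_def affine_connection_def by blast

lemma connection_add:
  assumes "X \<in> vector_fields A" "Y \<in> vector_fields A" "Z \<in> vector_fields A"
  shows "D (X + Y) Z = D X Z + D Y Z" "D X (Y + Z) = D X Y + D X Z"
  using connection assms unfolding levi_civita_def affine_connection_def by blast+

lemma connection_torsion_free:
  "X \<in> vector_fields A \<Longrightarrow> Y \<in> vector_fields A \<Longrightarrow> lie_bracket X Y = D X Y - D Y X"
  using connection unfolding levi_civita_def by metis

lemma connection_metric:
  assumes "X \<in> vector_fields A" "Y \<in> vector_fields A" "Z \<in> vector_fields A"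
  shows "X p (\<lambda>q. g q (Y q) (Z q)) = g p (D X Y p) (Z p) + g p (Y p) (D X Z p)"
  using connection assms unfolding levi_civita_def by blast

text \<open>A real scalar enters as a constant function, whose derivative term in the Leibniz rule
  vanishes.\<close>

lemma connection_scale:
  assumes "X \<in> vector_fields A" "Y \<in> vector_fields A"
  shows "D (c *\<^sub>R X) Y = c *\<^sub>R D X Y" "D X (c *\<^sub>R Y) = c *\<^sub>R D X Y"
proof -
  have scale: "fun_scale (\<lambda>_. c) Z = c *\<^sub>R Z" for Z :: "'a vfield"
    by (simp add: fun_scale_def scaleR_fun_def[of c Z])
  have "X p (\<lambda>_. c) = 0" for p
    using assms vector_field_tangent tangent_const by blast
  then have zero: "fun_scale (\<lambda>p. X p (\<lambda>_. c)) Y = 0"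
    by (simp add: fun_scale_def fun_eq_iff)
  have "D (fun_scale (\<lambda>_. c) X) Y = fun_scale (\<lambda>_. c) (D X Y)"
    "D X (fun_scale (\<lambda>_. c) Y) = fun_scale (\<lambda>p. X p (\<lambda>_. c)) Y + fun_scale (\<lambda>_. c) (D X Y)"
    using connection assms smooth_fun_const unfolding levi_civita_def affine_connection_def by blast+
  then show "D (c *\<^sub>R X) Y = c *\<^sub>R D X Y" "D X (c *\<^sub>R Y) = c *\<^sub>R D X Y"
    unfolding zero unfolding scale by simp_all
qed

lemma vector_fields_sum:
  assumes "\<And>i. i \<in> I \<Longrightarrow> X i \<in> vector_fields A"
  shows "(\<Sum>i\<in>I. c i *\<^sub>R X i) \<in> vector_fields A"
  using assms by (intro subspace_sum subspace_scale subspace_vector_fields)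

lemma connection_sum:
  assumes X: "\<And>i. i \<in> I \<Longrightarrow> X i \<in> vector_fields A" and Y: "Y \<in> vector_fields A"
  shows "D (\<Sum>i\<in>I. c i *\<^sub>R X i) Y = (\<Sum>i\<in>I. c i *\<^sub>R D (X i) Y)"
    and "D Y (\<Sum>i\<in>I. c i *\<^sub>R X i) = (\<Sum>i\<in>I. c i *\<^sub>R D Y (X i))"
proof -
  have zero: "D 0 Y = 0" "D Y 0 = 0"
    using connection_scale[OF Y Y, of 0] by simp_all
  have "D (\<Sum>i\<in>I. c i *\<^sub>R X i) Y = (\<Sum>i\<in>I. c i *\<^sub>R D (X i) Y) \<and>
      D Y (\<Sum>i\<in>I. c i *\<^sub>R X i) = (\<Sum>i\<in>I. c i *\<^sub>R D Y (X i))"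
    using X
  proof (induction I rule: infinite_finite_induct)
    case (insert i I)
    have i: "X i \<in> vector_fields A" "c i *\<^sub>R X i \<in> vector_fields A"
      using insert.prems subspace_scale[OF subspace_vector_fields] by blast+
    have I: "(\<Sum>i\<in>I. c i *\<^sub>R X i) \<in> vector_fields A"
      by (intro vector_fields_sum insert.prems) simp
    have IH: "D (\<Sum>i\<in>I. c i *\<^sub>R X i) Y = (\<Sum>i\<in>I. c i *\<^sub>R D (X i) Y)"
      "D Y (\<Sum>i\<in>I. c i *\<^sub>R X i) = (\<Sum>i\<in>I. c i *\<^sub>R D Y (X i))"
      using insert.IH insert.prems by blast+
    show ?case
      unfolding sum.insert[OF insert.hyps] connection_add(1)[OF i(2) I Y] connection_add(2)[OF Y i(2) I]
        connection_scale(1)[OF i(1) Y] connection_scale(2)[OF Y i(1)] IH by blast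
  qed (simp_all add: zero)
  then show "D (\<Sum>i\<in>I. c i *\<^sub>R X i) Y = (\<Sum>i\<in>I. c i *\<^sub>R D (X i) Y)"
    and "D Y (\<Sum>i\<in>I. c i *\<^sub>R X i) = (\<Sum>i\<in>I. c i *\<^sub>R D Y (X i))"
    by blast+
qed

text \<open>Torsion-freeness writes the bracket as a difference of values of \<open>D\<close>, so
  closure is inherited from \<open>D\<close>.\<close>

lemma lie_bracket_vector_field:
  assumes "X \<in> vector_fields A" "Y \<in> vector_fields A"
  shows "lie_bracket X Y \<in> vector_fields A"
  using assms
  by (simp add: connection_torsion_free connection_vector_field subspace_diff[OF subspace_vector_fields])

text \<open>Metric compatibility splits the derivative terms into six products, torsion-freeness
  splits the brackets into six more; all cancel except two copies of
  \<open>g p (D X Y p) (Z p)\<close>.\<close>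

lemma koszul:
  assumes X: "X \<in> vector_fields A" and Y: "Y \<in> vector_fields A" and Z: "Z \<in> vector_fields A"
  shows "2 * g p (D X Y p) (Z p) =
    X p (\<lambda>q. g q (Y q) (Z q)) + Y p (\<lambda>q. g q (X q) (Z q)) - Z p (\<lambda>q. g q (X q) (Y q))
    + g p (lie_bracket X Y p) (Z p) - g p (lie_bracket Y Z p) (X p) - g p (lie_bracket X Z p) (Y p)"
proof -
  note tangent = vector_field_tangent connection_vector_field
  have "g p (lie_bracket V W p) (U p) = g p (D V W p) (U p) - g p (D W V p) (U p)"
    if "U \<in> vector_fields A" "V \<in> vector_fields A" "W \<in> vector_fields A" for U V W
    using that by (simp add: connection_torsion_free metric_diff_left tangent)
  moreover have "g p (Y p) (D X Z p) = g p (D X Z p) (Y p)" "g p (X p) (D Y Z p) = g p (D Y Z p) (X p)"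
    "g p (X p) (D Z Y p) = g p (D Z Y p) (X p)"
    using X Y Z by (simp_all add: metric_sym tangent)
  ultimately show ?thesis
    using X Y Z by (simp add: connection_metric)
qed

section \<open>Naturality of the connection under left translations\<close>

lemma metric_related:
  assumes "X \<in> vector_fields A" "Y \<in> vector_fields A"
    and "translation_related a X X'" "translation_related a Y Y'"
  shows "g (mul a p) (X' (mul a p)) (Y' (mul a p)) = g p (X p) (Y p)"
  using assms by (simp add: translation_related_def metric_push vector_field_tangent)

lemma metric_derivative_related:
  assumes "X \<in> vector_fields A" "Y \<in> vector_fields A" "X' \<in> vector_fields A" "Y' \<in> vector_fields A"
    and "translation_related a X X'" "translation_related a Y Y'" "translation_related a Z Z'"
  shows "Z' (mul a p) (\<lambda>q. g q (X' q) (Y' q)) = Z p (\<lambda>q. g q (X q) (Y q))"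
  using derivative_related[OF assms(7) metric_smooth[OF assms(3,4)]] metric_related assms
  by (simp add: comp_def)

text \<open>Every term on the right of the Koszul formula is preserved by relatedness, hence so is
  its left-hand side.\<close>

lemma metric_connection_related:
  assumes "X \<in> vector_fields A" "Y \<in> vector_fields A" "Z \<in> vector_fields A"
    and "X' \<in> vector_fields A" "Y' \<in> vector_fields A" "Z' \<in> vector_fields A"
    and "translation_related a X X'" "translation_related a Y Y'" "translation_related a Z Z'"
  shows "g (mul a p) (D X' Y' (mul a p)) (Z' (mul a p)) = g p (D X Y p) (Z p)"
proof -
  have bracket: "g (mul a p) (lie_bracket V' W' (mul a p)) (U' (mul a p)) = g p (lie_bracket V W p) (U p)"
    if "U \<in> vector_fields A" "V \<in> vector_fields A" "W \<in> vector_fields A"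
      and "V' \<in> vector_fields A" "W' \<in> vector_fields A"
      and "translation_related a U U'" "translation_related a V V'" "translation_related a W W'"
    for U V W U' V' W'
    using that by (intro metric_related lie_bracket_related lie_bracket_vector_field)
  have "2 * g (mul a p) (D X' Y' (mul a p)) (Z' (mul a p)) = 2 * g p (D X Y p) (Z p)"
    unfolding koszul[OF assms(1-3)] koszul[OF assms(4-6)]
    using metric_derivative_related[OF assms(2,3,5,6,8,9,7), of p]
      metric_derivative_related[OF assms(1,3,4,6,7,9,8), of p]
      metric_derivative_related[OF assms(1,2,4,5,7,8,9), of p]
      bracket[OF assms(3,1,2,4,5,9,7,8)] bracket[OF assms(1,2,3,5,6,7,8,9)]
      bracket[OF assms(2,1,3,4,6,8,7,9)]
    by linarith
  then show ?thesis by simp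
qed

text \<open>The translate \<open>W\<close> of \<open>D X Y\<close> is compared with
  \<open>D X' Y'\<close> by pairing both with their difference \<open>Z'\<close>: the pairings
  agree, so \<open>Z'\<close> has norm zero everywhere and vanishes by definiteness.\<close>

lemma connection_related:
  assumes "X \<in> vector_fields A" "Y \<in> vector_fields A" "X' \<in> vector_fields A" "Y' \<in> vector_fields A"
    and "translation_related a X X'" "translation_related a Y Y'"
  shows "translation_related a (D X Y) (D X' Y')"
proof -
  define W where "W = translate a (D X Y)"
  define Z' where "Z' = W - D X' Y'"
  \<comment> \<open>Naturality of the pairing speaks of related test fields, so \<open>Z'\<close> is
    pulled back to \<open>Z\<close>.\<close>
  define Z where "Z = translate (ginv a) Z'"
  note DXY = connection_vector_field[OF assms(1,2)] and DX'Y' = connection_vector_field[OF assms(3,4)]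
  have W: "W \<in> vector_fields A" "translation_related a (D X Y) W"
    unfolding W_def using translate_in_vector_fields[OF DXY] translation_related_translate by blast+
  have Z': "Z' \<in> vector_fields A"
    unfolding Z'_def using W(1) DX'Y' by (rule subspace_diff[OF subspace_vector_fields])
  have Z: "Z \<in> vector_fields A" "translation_related a Z Z'"
    unfolding Z_def using translate_in_vector_fields[OF Z'] translate_related[OF Z'] by blast+
  have "Z' q = 0" for q
  proof -
    let ?p = "mul (ginv a) q"
    have "g (mul a ?p) (D X' Y' (mul a ?p)) (Z' (mul a ?p)) = g (mul a ?p) (W (mul a ?p)) (Z' (mul a ?p))"
      using metric_connection_related[OF assms(1,2) Z(1) assms(3,4) Z' assms(5,6) Z(2)]
        metric_related[OF DXY Z(1) W(2) Z(2)] by simp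
    then have "g q (D X' Y' q) (Z' q) = g q (W q) (Z' q)"
      by (simp only: mul_ginv_cancel)
    then have "g q (Z' q) (Z' q) = 0"
      using metric_diff_left[OF vector_field_tangent[OF W(1)] vector_field_tangent[OF DX'Y']
          vector_field_tangent[OF Z'], of q]
      by (simp add: Z'_def)
    then show ?thesis
      using metric_pos[OF vector_field_tangent[OF Z'], of q] by force
  qed
  then have "W = D X' Y'"
    by (simp add: Z'_def fun_eq_iff)
  with W(2) show ?thesis by simp
qed

lemma connection_left_invariant:
  "X \<in> left_invariant_fields A mul \<Longrightarrow> Y \<in> left_invariant_fields A mul \<Longrightarrow>
    D X Y \<in> left_invariant_fields A mul"
  using connection_related connection_vector_field by (simp add: left_invariant_iff)

end

section \<open>Orthonormal left invariant frames\<close>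

text \<open>The algebraic core. The first product yields the second Ricci term plus a multiple of
  the trace of \<open>ad [E j, E k]\<close>, removed by \<open>trace_ad\<close>; the other two
  products yield the first, third and fourth terms.\<close>

lemma ricci_structure_constants:
  fixes c \<Gamma> :: "'i::finite \<Rightarrow> 'i \<Rightarrow> 'i \<Rightarrow> real"
  assumes anti: "\<And>k i j. c k i j = - c k j i"
    and trace_ad: "(\<Sum>s\<in>UNIV. \<Sum>m\<in>UNIV. c m j k * c s s m) = 0"
    and \<Gamma>: "\<And>k i j. \<Gamma> k i j = (c k i j - c i j k - c j i k) / 2"
  shows "(\<Sum>s\<in>UNIV. \<Sum>m\<in>UNIV. \<Gamma> m j k * \<Gamma> s s m - \<Gamma> m s k * \<Gamma> s j m - c m s j * \<Gamma> s m k) =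
      - (1/2) * (\<Sum>s\<in>UNIV. \<Sum>m\<in>UNIV. c s m j * c m s k)
      + (1/2) * (\<Sum>s\<in>UNIV. \<Sum>m\<in>UNIV. c m m s * (c k s j + c j s k))
      + (1/4) * (\<Sum>s\<in>UNIV. \<Sum>m\<in>UNIV. c j s m * c k s m)
      - (1/2) * (\<Sum>s\<in>UNIV. \<Sum>m\<in>UNIV. c m s j * c m s k)"
proof -
  \<comment> \<open>\<open>F\<close> collects the last two products of the contraction,
    \<open>H\<close> the summands of the first, third and fourth Ricci terms.\<close>
  define F where "F s m = - \<Gamma> m s k * \<Gamma> s j m - c m s j * \<Gamma> s m k" for s m
  define H where "H s m = - (1/2) * (c s m j * c m s k) + (1/4) * (c j s m * c k s m)
    - (1/2) * (c m s j * c m s k)" for s m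
  \<comment> \<open>Antisymmetry reduces \<open>\<Gamma> s s m\<close> to \<open>c s s m\<close>;
    the other factor is split into its antisymmetric and symmetric parts in \<open>j\<close> and
    \<open>k\<close>.\<close>
  have A: "\<Gamma> m j k * \<Gamma> s s m = (1/2) * (c m j k * c s s m) + (1/2) * (c s s m * (c k m j + c j m k))" for s m
  proof -
    have "c m s s = 0" using anti[of m s s] by simp
    then have "\<Gamma> s s m = c s s m" using anti[of s m s] by (simp add: \<Gamma>)
    moreover have "\<Gamma> m j k = (c m j k + c j m k + c k m j) / 2"
      using anti[of j k m] anti[of k j m] by (simp add: \<Gamma>)
    ultimately show ?thesis by (simp only: add_divide_distrib) (simp add: algebra_simps)
  qed
  text \<open>Only the sums agree: \<open>F\<close> and \<open>H\<close> differ by a function antisymmetric in \<open>s\<close> and \<open>m\<close>.\<close>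
  have "F s m + F m s = H s m + H m s" for s m
    by (simp add: F_def H_def \<Gamma> anti[of s k m] anti[of m k s] anti[of s j m] anti[of m j s]
        anti[of j m s] anti[of k m s] field_simps)
  then have "(\<Sum>s\<in>UNIV. \<Sum>m\<in>UNIV. F s m + F m s) = (\<Sum>s\<in>UNIV. \<Sum>m\<in>UNIV. H s m + H m s)"
    by simp
  moreover have "(\<Sum>s\<in>UNIV. \<Sum>m\<in>UNIV. K s m + K m s) = 2 * (\<Sum>s\<in>UNIV. \<Sum>m\<in>UNIV. K s m)"
    for K :: "'i \<Rightarrow> 'i \<Rightarrow> real"
    using sum.swap[of K UNIV UNIV] by (simp add: sum.distrib)
  ultimately have FH: "(\<Sum>s\<in>UNIV. \<Sum>m\<in>UNIV. F s m) = (\<Sum>s\<in>UNIV. \<Sum>m\<in>UNIV. H s m)"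
    by simp
  have "(\<Sum>s\<in>UNIV. \<Sum>m\<in>UNIV. \<Gamma> m j k * \<Gamma> s s m - \<Gamma> m s k * \<Gamma> s j m - c m s j * \<Gamma> s m k) =
      (\<Sum>s\<in>UNIV. \<Sum>m\<in>UNIV. \<Gamma> m j k * \<Gamma> s s m) + (\<Sum>s\<in>UNIV. \<Sum>m\<in>UNIV. F s m)"
    by (simp add: F_def algebra_simps flip: sum.distrib)
  \<comment> \<open>The antisymmetric part sums to zero by \<open>trace_ad\<close>; exchanging
    \<open>s\<close> and \<open>m\<close> in the symmetric part gives the second Ricci term.\<close>
  also have "(\<Sum>s\<in>UNIV. \<Sum>m\<in>UNIV. \<Gamma> m j k * \<Gamma> s s m) =
      (1/2) * (\<Sum>s\<in>UNIV. \<Sum>m\<in>UNIV. c m m s * (c k s j + c j s k))"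
    using trace_ad sum.swap[of "\<lambda>s m. c s s m * (c k m j + c j m k)" UNIV UNIV]
    by (simp only: A sum.distrib flip: sum_distrib_left)
  finally show ?thesis
    unfolding FH by (simp add: H_def sum.distrib sum_subtractf sum_negf sum_distrib_left)
qed

locale lie_group_frame = lie_group_levi_civita A mul e ginv g D
  for A :: "('a::{t2_space, second_countable_topology}, 'e::euclidean_space) atlas"
    and mul :: "'a \<Rightarrow> 'a \<Rightarrow> 'a" and e :: 'a and ginv :: "'a \<Rightarrow> 'a"
    and g :: "'a \<Rightarrow> 'a tangent \<Rightarrow> 'a tangent \<Rightarrow> real"
    and D :: "'a vfield \<Rightarrow> 'a vfield \<Rightarrow> 'a vfield" +
  fixes E :: "'i::finite \<Rightarrow> 'a vfield"
    and c :: "'i \<Rightarrow> 'i \<Rightarrow> 'i \<Rightarrow> real"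
  assumes span_frame: "span (range E) = left_invariant_fields A mul"
    and orthonormal: "\<And>i j. lie_scalar_product g e (E i) (E j) = (if i = j then 1 else 0)"
    and structure_constants: "\<And>i j. lie_bracket (E i) (E j) = (\<Sum>k\<in>UNIV. c k i j *\<^sub>R E k)"
begin

text \<open>The coefficients of \<open>D\<close> in the frame, upper index first; each summand comes
  from one bracket in the Koszul formula.\<close>

definition christoffel :: "'i \<Rightarrow> 'i \<Rightarrow> 'i \<Rightarrow> real" where
  "christoffel k i j = (c k i j - c i j k - c j i k) / 2"

section \<open>The frame as a basis, globally and at each point\<close>

lemma frame_left_invariant: "E i \<in> left_invariant_fields A mul"
  unfolding span_frame[symmetric] by (intro span_base rangeI)

lemma frame_vector_field: "E i \<in> vector_fields A"
  using frame_left_invariant left_invariant_iff by blast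

lemma frame_tangent: "E i p \<in> tangent_space A p"
  by (intro vector_field_tangent frame_vector_field)

text \<open>Since \<open>p\<close> is \<open>mul p e\<close>, invariance of metric and frame carries
  orthonormality from \<open>e\<close> to \<open>p\<close>.\<close>

lemma frame_orthonormal: "g p (E i p) (E j p) = (if i = j then 1 else 0)"
proof -
  have "translation_related p (E k) (E k)" for k
    using frame_left_invariant left_invariant_iff by blast
  then have "g (mul p e) (E i (mul p e)) (E j (mul p e)) = g e (E i e) (E j e)"
    by (intro metric_related frame_vector_field)
  moreover have "mul p e = p" by simp
  ultimately show ?thesis
    using orthonormal[of i j] by (simp add: lie_scalar_product_def)
qed

lemma frame_coefficient: "g p (\<Sum>i\<in>UNIV. a i *\<^sub>R E i p) (E j p) = a j"
  by (simp add: metric_sum_left frame_tangent frame_orthonormal if_distrib cong: if_cong)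

text \<open>Scaling is pointwise on two levels, fields and tangent vectors; instantiating
  \<open>scaleR_fun_def\<close> at \<open>E _\<close> unfolds the outer one only.\<close>

lemma frame_sum_apply: "(\<Sum>i\<in>I. a i *\<^sub>R E i) p = (\<Sum>i\<in>I. a i *\<^sub>R E i p)"
  by (induction I rule: infinite_finite_induct) (simp_all add: scaleR_fun_def[of _ "E _"])

lemma frame_coefficients_unique:
  assumes "(\<Sum>i\<in>UNIV. a i *\<^sub>R E i) = (\<Sum>i\<in>UNIV. b i *\<^sub>R E i)"
  shows "a j = b j"
proof -
  have "g e ((\<Sum>i\<in>UNIV. a i *\<^sub>R E i) e) (E j e) = g e ((\<Sum>i\<in>UNIV. b i *\<^sub>R E i) e) (E j e)"
    by (simp only: assms)
  then show ?thesis by (simp only: frame_sum_apply frame_coefficient)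
qed

lemma inj_frame: "inj (\<lambda>i. E i p)"
proof (rule injI)
  show "i = j" if "E i p = E j p" for i j
    using that frame_orthonormal[of p i j] frame_orthonormal[of p j j] by (simp split: if_splits)
qed

text \<open>Pairing a vanishing combination with \<open>E j p\<close> isolates the coefficient of
  \<open>E j p\<close>.\<close>

lemma independent_frame: "independent (range (\<lambda>i. E i p))"
proof -
  have "\<forall>v\<in>range (\<lambda>i. E i p). u v = 0" if "(\<Sum>v\<in>range (\<lambda>i. E i p). u v *\<^sub>R v) = 0" for u
  proof (rule ballI, erule imageE)
    fix v j assume v: "v = E j p"
    have "(\<Sum>i\<in>UNIV. u (E i p) *\<^sub>R E i p) = (\<Sum>i\<in>UNIV. 0 *\<^sub>R E i p)"
      using that by (simp add: sum.reindex[OF inj_frame] comp_def)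
    then show "u v = 0"
      unfolding v using frame_coefficient[of p "\<lambda>i. u (E i p)" j] frame_coefficient[of p "\<lambda>i. 0" j]
      by (simp only:)
  qed
  then show ?thesis
    unfolding dependent_finite[OF finite_imageI[OF finite]] by blast
qed

text \<open>\<open>representation\<close> is zero by default on dependent sets and outside the span;
  independence of the frame values makes it return the true coefficients.\<close>

lemma representation_frame:
  "representation (range (\<lambda>i. E i p)) (\<Sum>i\<in>UNIV. a i *\<^sub>R E i p) (E j p) = a j"
proof -
  let ?B = "range (\<lambda>i. E i p)"
  have span: "E i p \<in> span ?B" for i
    by (intro span_base rangeI)
  have basis: "representation ?B (E i p) (E j p) = (if i = j then 1 else 0)" for i
    by (auto simp: representation_basis[OF independent_frame] dest: injD[OF inj_frame])
  have "representation ?B (\<Sum>i\<in>UNIV. a i *\<^sub>R E i p) (E j p)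
      = (\<Sum>i\<in>UNIV. a i * representation ?B (E i p) (E j p))"
    by (simp add: representation_sum[OF independent_frame] representation_scale[OF independent_frame]
        span span_scale)
  then show ?thesis by (simp add: basis if_distrib cong: if_cong)
qed

lemma left_invariant_frame_sum:
  assumes "X \<in> left_invariant_fields A mul"
  obtains a where "X = (\<Sum>i\<in>UNIV. a i *\<^sub>R E i)"
proof -
  \<comment> \<open>Distinct indices already give distinct values at \<open>e\<close>, so the sum
    over the set \<open>range E\<close> becomes a sum over indices.\<close>
  have "inj E"
    by (intro injI injD[OF inj_frame[of e]]) simp
  moreover obtain u where "X = (\<Sum>v\<in>range E. u v *\<^sub>R v)"
    using assms unfolding span_frame[symmetric] span_finite[OF finite_imageI[OF finite]] by blast
  ultimately have "X = (\<Sum>i\<in>UNIV. u (E i) *\<^sub>R E i)"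
    by (simp add: sum.reindex)
  then show ?thesis by (rule that)
qed

lemma connection_frame: "D (E i) (E j) = (\<Sum>k\<in>UNIV. christoffel k i j *\<^sub>R E k)"
proof -
  obtain a where a: "D (E i) (E j) = (\<Sum>k\<in>UNIV. a k *\<^sub>R E k)"
    using left_invariant_frame_sum connection_left_invariant frame_left_invariant by blast
  \<comment> \<open>Inner products of frame fields are constant functions, in the \<open>if\<close>
    form produced by \<open>frame_orthonormal\<close>; this removes the derivative terms.\<close>
  have const: "E l p (\<lambda>q. if b then 1 else 0) = 0" for l p b
    by (rule tangent_const[OF frame_tangent])
  have "a k = christoffel k i j" for k
  proof -
    have "2 * a k = c k i j - c i j k - c j i k"
      using koszul[OF frame_vector_field[of i] frame_vector_field[of j] frame_vector_field[of k], of e]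
      by (simp only: a structure_constants frame_sum_apply frame_coefficient frame_orthonormal const)
    then show ?thesis by (simp add: christoffel_def)
  qed
  with a show ?thesis by simp
qed

section \<open>Lie algebra identities for the structure constants\<close>

lemma structure_constants_anti: "c k i j = - c k j i"
proof -
  have "(\<Sum>k\<in>UNIV. c k i j *\<^sub>R E k) = (\<Sum>k\<in>UNIV. (- c k j i) *\<^sub>R E k)"
    using lie_bracket_anti[of "E i" "E j"]
    by (simp only: structure_constants scaleR_minus_left sum_negf)
  then show ?thesis by (rule frame_coefficients_unique)
qed

lemma combination_frame_sum:
  "(\<Sum>m\<in>UNIV. a m *\<^sub>R (\<Sum>l\<in>UNIV. b l m *\<^sub>R E l)) = (\<Sum>l\<in>UNIV. (\<Sum>m\<in>UNIV. a m * b l m) *\<^sub>R E l)"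
  unfolding scaleR_sum_right scaleR_sum_left scaleR_scaleR by (rule sum.swap)

text \<open>Linearity of the bracket is borrowed from both arguments of \<open>D\<close> through
  torsion-freeness.\<close>

lemma lie_bracket_frame_sum:
  "lie_bracket (E i) (\<Sum>m\<in>UNIV. a m *\<^sub>R E m) = (\<Sum>l\<in>UNIV. (\<Sum>m\<in>UNIV. a m * c l i m) *\<^sub>R E l)"
proof -
  have "lie_bracket (E i) (\<Sum>m\<in>UNIV. a m *\<^sub>R E m)
      = (\<Sum>m\<in>UNIV. a m *\<^sub>R D (E i) (E m)) - (\<Sum>m\<in>UNIV. a m *\<^sub>R D (E m) (E i))"
    by (simp only: connection_torsion_free connection_sum vector_fields_sum frame_vector_field)
  also have "\<dots> = (\<Sum>m\<in>UNIV. a m *\<^sub>R lie_bracket (E i) (E m))"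
    by (simp only: connection_torsion_free frame_vector_field scaleR_diff_right sum_subtractf)
  finally show ?thesis
    by (simp only: structure_constants combination_frame_sum)
qed

lemma structure_constants_jacobi:
  "(\<Sum>m\<in>UNIV. c m j k * c l i m) + (\<Sum>m\<in>UNIV. c m k i * c l j m) + (\<Sum>m\<in>UNIV. c m i j * c l k m) = 0"
proof -
  have "(\<Sum>l\<in>UNIV. ((\<Sum>m\<in>UNIV. c m j k * c l i m) + (\<Sum>m\<in>UNIV. c m k i * c l j m)
      + (\<Sum>m\<in>UNIV. c m i j * c l k m)) *\<^sub>R E l) = (\<Sum>l\<in>UNIV. 0 *\<^sub>R E l)"
    using lie_bracket_jacobi[OF frame_vector_field[of i] frame_vector_field[of j] frame_vector_field[of k]]
    by (simp only: structure_constants lie_bracket_frame_sum scaleR_add_left sum.distrib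
        scaleR_zero_left sum.neutral_const)
  then show ?thesis by (rule frame_coefficients_unique)
qed

lemma trace_ad_lie_bracket: "(\<Sum>s\<in>UNIV. \<Sum>m\<in>UNIV. c m j k * c s s m) = 0"
proof -
  \<comment> \<open>The Jacobi identity with \<open>i\<close> and \<open>l\<close> both equal to
    \<open>s\<close>, summed over \<open>s\<close>.\<close>
  have "(\<Sum>s\<in>UNIV. (\<Sum>m\<in>UNIV. c m j k * c s s m) + (\<Sum>m\<in>UNIV. c m k s * c s j m)
      + (\<Sum>m\<in>UNIV. c m s j * c s k m)) = 0"
    by (simp only: structure_constants_jacobi sum.neutral_const)
  \<comment> \<open>Up to sign these are the traces of the two products of \<open>ad (E j)\<close>
    and \<open>ad (E k)\<close>; the index swap is cyclicity of the trace.\<close>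
  moreover have "(\<Sum>s\<in>UNIV. \<Sum>m\<in>UNIV. c m s j * c s k m) = - (\<Sum>s\<in>UNIV. \<Sum>m\<in>UNIV. c m k s * c s j m)"
    using sum.swap[of "\<lambda>s m. c m k s * c s j m" UNIV UNIV]
    by (simp add: structure_constants_anti[of _ _ j] mult.commute flip: sum_negf)
  ultimately show ?thesis
    by (simp add: sum.distrib)
qed

text \<open>All coefficients are real constants, so \<open>D\<close> acts on the expansions by
  linearity, without derivative terms.\<close>

lemma curvature_frame:
  "curvature D (E s) (E j) (E k) = (\<Sum>l\<in>UNIV. (\<Sum>m\<in>UNIV. christoffel m j k * christoffel l s m
    - christoffel m s k * christoffel l j m - c m s j * christoffel l m k) *\<^sub>R E l)"
  by (simp only: curvature_def connection_frame structure_constants connection_sum frame_vector_field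
      combination_frame_sum scaleR_diff_left sum_subtractf)

text \<open>Contraction sets \<open>l\<close> to \<open>s\<close> in \<open>curvature_frame\<close>,
  whose coefficients are the same at every \<open>p\<close>.\<close>

lemma ricci_frame:
  "ricci_coord D E p j k =
      - (1/2) * (\<Sum>s\<in>UNIV. \<Sum>m\<in>UNIV. c s m j * c m s k)
      + (1/2) * (\<Sum>s\<in>UNIV. \<Sum>m\<in>UNIV. c m m s * (c k s j + c j s k))
      + (1/4) * (\<Sum>s\<in>UNIV. \<Sum>m\<in>UNIV. c j s m * c k s m)
      - (1/2) * (\<Sum>s\<in>UNIV. \<Sum>m\<in>UNIV. c m s j * c m s k)"
proof -
  have "ricci_coord D E p j k = (\<Sum>s\<in>UNIV. \<Sum>m\<in>UNIV. christoffel m j k * christoffel s s m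
      - christoffel m s k * christoffel s j m - c m s j * christoffel s m k)"
    unfolding ricci_coord_def curvature_coord_def curvature_frame frame_sum_apply representation_frame ..
  then show ?thesis
    using ricci_structure_constants[OF structure_constants_anti trace_ad_lie_bracket christoffel_def]
    by simp
qed

end

theorem proposition2:
  fixes A :: "('a::{t2_space, second_countable_topology}, real ^ 'n) atlas"
    and mul :: "'a \<Rightarrow> 'a \<Rightarrow> 'a" and e :: 'a and ginv :: "'a \<Rightarrow> 'a"
    and g :: "'a \<Rightarrow> 'a tangent \<Rightarrow> 'a tangent \<Rightarrow> real"
    and D :: "'a vfield \<Rightarrow> 'a vfield \<Rightarrow> 'a vfield"
    and E :: "'n \<Rightarrow> 'a vfield"
    and c :: "'n \<Rightarrow> 'n \<Rightarrow> 'n \<Rightarrow> real"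
  assumes G: "lie_group A mul e ginv"
    and metric: "riemannian_metric A g" "left_invariant_metric A mul g"
    and LC: "levi_civita A g D"
    and basis: "inj E" "independent (range E)" "span (range E) = left_invariant_fields A mul"
    and orthonormal: "\<And>i j. lie_scalar_product g e (E i) (E j) = (if i = j then 1 else 0)"
    and structure_constants: "\<And>i j. lie_bracket (E i) (E j) = (\<Sum>k\<in>UNIV. c k i j *\<^sub>R E k)"
  shows "\<forall>p j k. ricci_coord D E p j k =
      - (1/2) * (\<Sum>s\<in>UNIV. \<Sum>m\<in>UNIV. c s m j * c m s k)
      + (1/2) * (\<Sum>s\<in>UNIV. \<Sum>m\<in>UNIV. c m m s * (c k s j + c j s k))
      + (1/4) * (\<Sum>s\<in>UNIV. \<Sum>m\<in>UNIV. c j s m * c k s m)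
      - (1/2) * (\<Sum>s\<in>UNIV. \<Sum>m\<in>UNIV. c m s j * c m s k)"
proof -
  interpret lie_group A mul e ginv by (rule G)
  interpret lie_group_frame A mul e ginv g D E c
    using metric LC basis(3) orthonormal structure_constants by unfold_locales
  show ?thesis using ricci_frame by blast
qed

end
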